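(* Let $\gamma\geq 1$ and let $G$ be the Tanner graph of a variable-regular LDPC code with column weight $\gamma$. Suppose $G$ has girth at least $10$. Then there is no $(a,b)$ elementary trapping set in $G$ with $\frac{b}{a}<1$ of size less than $(\gamma-1)^2+1$; that is, every $(a,b)$ elementary trapping set of $G$ with $\frac{b}{a}<1$ satisfies $a\geq(\gamma-1)^2+1$.
   Context: A Tanner graph is a finite simple bipartite graph with vertex classes $V$ (variable nodes) and $C$ (check nodes). The code is variable-regular with column weight $\gamma$ if every variable node has degree $\gamma$ in the Tanner graph. The girth is the length of a shortest cycle. For a nonempty subset $S\subseteq V$ with $|S|=a$, consider the subgraph of the Tanner graph induced by $S$ together with all check nodes adjacent to some element of $S$; if exactly $b$ of these check nodes have odd degree in this subgraph, it is called an $(a,b)$ trapping set of size $a$. It is an elementary trapping set (ETS) if every one of these check nodes has degree $1$ or $2$ in the subgraph (so $b$ is the number of degree-one check nodes). *)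

theory Defs
  imports Complex_Main "HOL-Library.Extended_Nat"
begin

text \<open>An undirected simple graph is given by its set of edges, each edge being a two-element set
  of vertices.\<close>

definition degree :: "'a set set \<Rightarrow> 'a \<Rightarrow> nat" where
  "degree E x = card {e \<in> E. x \<in> e}"

definition induced_edges :: "'a set set \<Rightarrow> 'a set \<Rightarrow> 'a set set" where
  "induced_edges E U = {e \<in> E. e \<subseteq> U}"

text \<open>A cycle is listed without repeating its first vertex at the end, so its length is the
  length of the list.\<close>

definition is_cycle :: "'a set set \<Rightarrow> 'a list \<Rightarrow> bool" where
  "is_cycle E xs \<longleftrightarrow>
     3 \<le> length xs \<and> distinct xs \<and>
     (\<forall>i < length xs. {xs ! i, xs ! (Suc i mod length xs)} \<in> E)"

text \<open>The infimum over the empty set is \<open>\<infinity>\<close>, so acyclic graphs have infinite girth.\<close>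

definition girth :: "'a set set \<Rightarrow> enat" where
  "girth E = (INF xs \<in> {xs. is_cycle E xs}. enat (length xs))"

locale tanner_graph =
  fixes V :: "'a set" and C :: "'a set" and E :: "'a set set"
  assumes finite_V: "finite V"
    and finite_C: "finite C"
    and disjoint: "V \<inter> C = {}"
    and edge_bipartite: "e \<in> E \<Longrightarrow> \<exists>v \<in> V. \<exists>c \<in> C. e = {v, c}"

definition variable_regular :: "'a set \<Rightarrow> 'a set set \<Rightarrow> nat \<Rightarrow> bool" where
  "variable_regular V E \<gamma> \<longleftrightarrow> (\<forall>v \<in> V. degree E v = \<gamma>)"

definition adjacent_checks :: "'a set \<Rightarrow> 'a set set \<Rightarrow> 'a set \<Rightarrow> 'a set" where
  "adjacent_checks C E S = {c \<in> C. \<exists>v \<in> S. {v, c} \<in> E}"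

definition trapping_subgraph :: "'a set \<Rightarrow> 'a set set \<Rightarrow> 'a set \<Rightarrow> 'a set set" where
  "trapping_subgraph C E S = induced_edges E (S \<union> adjacent_checks C E S)"

definition trapping_set ::
    "'a set \<Rightarrow> 'a set \<Rightarrow> 'a set set \<Rightarrow> nat \<Rightarrow> nat \<Rightarrow> 'a set \<Rightarrow> bool" where
  "trapping_set V C E a b S \<longleftrightarrow>
     S \<subseteq> V \<and> S \<noteq> {} \<and> card S = a \<and>
     card {c \<in> adjacent_checks C E S. odd (degree (trapping_subgraph C E S) c)} = b"

definition elementary_trapping_set ::
    "'a set \<Rightarrow> 'a set \<Rightarrow> 'a set set \<Rightarrow> nat \<Rightarrow> nat \<Rightarrow> 'a set \<Rightarrow> bool" where
  "elementary_trapping_set V C E a b S \<longleftrightarrow>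
     trapping_set V C E a b S \<and>
     (\<forall>c \<in> adjacent_checks C E S. degree (trapping_subgraph C E S) c \<in> {1, 2})"

end

theory Submission
  imports Defs
begin

text \<open>Join two elements of \<open>S\<close> whenever they share a check. Since the trapping set is elementary
  and the Tanner graph has no cycle of length 4, 6 or 8, this gives a simple graph on \<open>a\<close> vertices
  without triangles or 4-cycles, whose degree sum is \<open>\<gamma> a - b > (\<gamma> - 1) a\<close>. In such a graph a
  vertex, its neighbours and their neighbours are pairwise distinct, so the degrees of the
  neighbours of any vertex add up to at most \<open>a - 1\<close>. Summing over all vertices, the squared
  degrees add up to at most \<open>a (a - 1)\<close>, while by convexity they add up to at least
  \<open>a (\<gamma> - 1)\<^sup>2\<close>.\<close>

section \<open>Counting in graphs without triangles and 4-cycles\<close>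

lemma sum_neighbour_degrees_less:
  fixes N :: "'a \<Rightarrow> 'a set"
  assumes "finite S" and N: "\<And>v. v \<in> S \<Longrightarrow> N v \<subseteq> S"
    and sym: "\<And>u v. u \<in> S \<Longrightarrow> v \<in> S \<Longrightarrow> u \<in> N v \<Longrightarrow> v \<in> N u"
    and irrefl: "\<And>v. v \<in> S \<Longrightarrow> v \<notin> N v"
    and no3: "\<And>u v w. v \<in> S \<Longrightarrow> u \<in> N v \<Longrightarrow> w \<in> N v \<Longrightarrow> u \<notin> N w"
    and no4: "\<And>u v w x. v \<in> S \<Longrightarrow> u \<in> N v \<Longrightarrow> w \<in> N v \<Longrightarrow> u \<noteq> w \<Longrightarrow> x \<in> N u \<Longrightarrow> x \<in> N w \<Longrightarrow> x = v"
    and v: "v \<in> S"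
  shows "(\<Sum>u\<in>N v. card (N u)) < card S"
proof -
  \<comment> \<open>Trading \<open>v\<close> for \<open>u\<close> keeps the size
    \<open>card (N u)\<close> and yields blocks that avoid \<open>v\<close>.\<close>
  let ?B = "\<lambda>u. insert u (N u - {v})"
  have fin: "finite (N u)" if "u \<in> S" for u
    using N[OF that] \<open>finite S\<close> finite_subset by blast
  have card_B: "card (?B u) = card (N u)" if "u \<in> N v" for u
  proof -
    have "u \<in> S" using N v that by blast
    then show ?thesis
      using sym[OF _ v that] irrefl[of u] fin[of u]
      by (metis Diff_iff card_Suc_Diff1 card_insert_disjoint finite_Diff)
  qed
  have "(\<Sum>u\<in>N v. card (N u)) = (\<Sum>u\<in>N v. card (?B u))"
    using card_B by simp
  also have "\<dots> = card (\<Union>u\<in>N v. ?B u)"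
  proof (rule card_UN_disjoint[symmetric])
    show "\<forall>u\<in>N v. finite (?B u)" using fin N v by blast
    \<comment> \<open>By \<open>no3\<close> neither centre lies in the other block; by
      \<open>no4\<close> a common neighbour of \<open>u\<close> and \<open>w\<close> could only be
      \<open>v\<close>, which was removed.\<close>
    show "\<forall>u\<in>N v. \<forall>w\<in>N v. u \<noteq> w \<longrightarrow> ?B u \<inter> ?B w = {}"
      using no3[OF v] no4[OF v] by fast
  qed (use fin v in blast)
  also have "\<dots> < card S"
  proof (rule psubset_card_mono)
    \<comment> \<open>The inclusion is strict because \<open>v\<close> itself lies in no
      block.\<close>
    show "(\<Union>u\<in>N v. ?B u) \<subset> S" using N v irrefl[OF v] by blast
  qed fact
  finally show ?thesis .
qed

text \<open>The usual Moore count from one vertex needs a minimum degree. Here only the degree sum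
  is bounded below, so the count is summed over all starting vertices.\<close>

lemma moore_bound_girth_5:
  fixes N :: "'a \<Rightarrow> 'a set"
  assumes "finite S" "S \<noteq> {}" and N: "\<And>v. v \<in> S \<Longrightarrow> N v \<subseteq> S"
    and sym: "\<And>u v. u \<in> S \<Longrightarrow> v \<in> S \<Longrightarrow> u \<in> N v \<Longrightarrow> v \<in> N u"
    and irrefl: "\<And>v. v \<in> S \<Longrightarrow> v \<notin> N v"
    and no3: "\<And>u v w. v \<in> S \<Longrightarrow> u \<in> N v \<Longrightarrow> w \<in> N v \<Longrightarrow> u \<notin> N w"
    and no4: "\<And>u v w x. v \<in> S \<Longrightarrow> u \<in> N v \<Longrightarrow> w \<in> N v \<Longrightarrow> u \<noteq> w \<Longrightarrow> x \<in> N u \<Longrightarrow> x \<in> N w \<Longrightarrow> x = v"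
    and deg: "k * card S \<le> (\<Sum>v\<in>S. card (N v))"
  shows "k\<^sup>2 + 1 \<le> card S"
proof -
  let ?d = "\<lambda>v. card (N v)"
  have fin: "finite (N v)" if "v \<in> S" for v
    using N[OF that] \<open>finite S\<close> finite_subset by blast
  \<comment> \<open>After swapping the sums, the degree of \<open>u\<close> is counted once per
    neighbour of \<open>u\<close>, hence squared.\<close>
  have "(\<Sum>v\<in>S. \<Sum>u\<in>N v. ?d u) = (\<Sum>v\<in>S. \<Sum>u\<in>{u\<in>S. u \<in> N v}. ?d u)"
    by (intro sum.cong) (use N in auto)
  also have "\<dots> = (\<Sum>u\<in>S. \<Sum>v\<in>{v\<in>S. u \<in> N v}. ?d u)"
    by (rule sum.swap_restrict) fact+
  also have "\<dots> = (\<Sum>u\<in>S. \<Sum>v\<in>N u. ?d u)"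
    by (intro sum.cong) (use N sym in blast)+
  finally have swap: "(\<Sum>v\<in>S. \<Sum>u\<in>N v. ?d u) = (\<Sum>u\<in>S. (?d u)\<^sup>2)"
    by (simp add: power2_eq_square)
  have "Suc (\<Sum>u\<in>N v. ?d u) \<le> card S" if "v \<in> S" for v
    using sum_neighbour_degrees_less[OF \<open>finite S\<close> N sym irrefl no3 no4 that] by (rule Suc_leI)
  then have "(\<Sum>v\<in>S. Suc (\<Sum>u\<in>N v. ?d u)) \<le> card S * card S"
    using sum_bounded_above[of S "\<lambda>v. Suc (\<Sum>u\<in>N v. ?d u)" "card S"] by simp
  then have upper: "card S + (\<Sum>u\<in>S. (?d u)\<^sup>2) \<le> card S * card S"
    by (simp add: sum_Suc swap)
  \<comment> \<open>Convexity, obtained by expanding squares; the integers are used since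
    \<open>?d v\<close> may be below \<open>k\<close>.\<close>
  have "0 \<le> (\<Sum>v\<in>S. (int (?d v) - int k)\<^sup>2)"
    by (intro sum_nonneg) simp
  also have "\<dots> = (\<Sum>v\<in>S. (int (?d v))\<^sup>2) + int (card S) * (int k)\<^sup>2 - 2 * int k * (\<Sum>v\<in>S. int (?d v))"
    by (simp add: power2_diff sum.distrib sum_subtractf sum_distrib_left mult_ac)
  finally have "2 * int k * (\<Sum>v\<in>S. int (?d v)) \<le> (\<Sum>v\<in>S. (int (?d v))\<^sup>2) + int (card S) * (int k)\<^sup>2"
    by simp
  moreover have "2 * int k * int (k * card S) \<le> 2 * int k * (\<Sum>v\<in>S. int (?d v))"
    by (intro mult_left_mono) (use deg in \<open>simp_all flip: of_nat_sum of_nat_mult\<close>)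
  ultimately have "int (card S) * (int k)\<^sup>2 \<le> (\<Sum>v\<in>S. (int (?d v))\<^sup>2)"
    by (simp add: power2_eq_square algebra_simps)
  then have "int (card S * k\<^sup>2) \<le> int (\<Sum>v\<in>S. (?d v)\<^sup>2)"
    by simp
  then have "card S * k\<^sup>2 \<le> (\<Sum>v\<in>S. (?d v)\<^sup>2)"
    by (simp only: of_nat_le_iff)
  with upper have "card S * (k\<^sup>2 + 1) \<le> card S * card S"
    by simp
  moreover have "0 < card S"
    using assms(1,2) by (simp add: card_gt_0_iff)
  ultimately show ?thesis
    using mult_le_cancel1 by blast
qed

section \<open>Degrees and short cycles in Tanner graphs\<close>

lemma girth_le_length:
  assumes "is_cycle E xs"
  shows "girth E \<le> enat (length xs)"
  unfolding girth_def by (rule INF_lower) (use assms in simp)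

context tanner_graph
begin

lemma variable_neq_check:
  assumes "v \<in> V" "c \<in> C"
  shows "v \<noteq> c" "c \<noteq> v"
  using assms disjoint by auto

lemma edgeD:
  assumes "{v, c} \<in> E" "v \<in> V"
  shows "c \<in> C"
  using edge_bipartite[OF assms(1)] assms(2) disjoint by (auto simp: doubleton_eq_iff)

lemma degree_variable:
  assumes "v \<in> V"
  shows "degree E v = card {c \<in> C. {v, c} \<in> E}"
proof -
  have "{e \<in> E. v \<in> e} = (\<lambda>c. {v, c}) ` {c \<in> C. {v, c} \<in> E}"
    using edge_bipartite assms disjoint by fastforce
  moreover have "inj_on (\<lambda>c. {v, c}) {c \<in> C. {v, c} \<in> E}"
    by (auto simp: inj_on_def doubleton_eq_iff)
  ultimately show ?thesis
    by (simp add: degree_def card_image)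
qed

text \<open>An edge at \<open>c\<close> has a variable node as its other end, and the induced vertex
  set contains no variable nodes outside \<open>S\<close>.\<close>

lemma degree_check:
  assumes "S \<subseteq> V" "c \<in> adjacent_checks C E S"
  shows "degree (trapping_subgraph C E S) c = card {v \<in> S. {v, c} \<in> E}"
proof -
  have c: "c \<in> C" "c \<notin> V"
    using assms disjoint by (auto simp: adjacent_checks_def)
  have "{e \<in> trapping_subgraph C E S. c \<in> e} = (\<lambda>v. {v, c}) ` {v \<in> S. {v, c} \<in> E}" (is "?L = ?R")
  proof
    show "?R \<subseteq> ?L"
      using assms by (auto simp: trapping_subgraph_def induced_edges_def)
    show "?L \<subseteq> ?R"
    proof
      fix e assume e: "e \<in> ?L"
      then obtain v d where "v \<in> V" "d \<in> C" "e = {v, d}"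
        using edge_bipartite[of e] by (auto simp: trapping_subgraph_def induced_edges_def)
      with e c have "e = {v, c}" "v \<in> S" "e \<in> E"
        using disjoint by (auto simp: trapping_subgraph_def induced_edges_def adjacent_checks_def)
      then show "e \<in> ?R" by auto
    qed
  qed
  moreover have "inj_on (\<lambda>v. {v, c}) {v \<in> S. {v, c} \<in> E}"
    by (auto simp: inj_on_def doubleton_eq_iff)
  ultimately show ?thesis
    by (simp add: degree_def card_image)
qed

lemma no_4_cycle:
  assumes "girth E \<ge> 10"
    and "{u, c} \<in> E" "{v, c} \<in> E" "{u, d} \<in> E" "{v, d} \<in> E"
    and "u \<in> V" "v \<in> V" "u \<noteq> v"
  shows "c = d"
proof (rule ccontr)
  assume "c \<noteq> d"
  moreover have "c \<in> C" "d \<in> C"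
    using assms edgeD by blast+
  ultimately have "is_cycle E [u, c, v, d]"
    using assms by (simp add: is_cycle_def All_less_Suc2 insert_commute variable_neq_check)
  from girth_le_length[OF this] assms(1) have "(10::enat) \<le> enat 4"
    using order_trans by fastforce
  then show False by (simp add: numeral_eq_enat)
qed

text \<open>Three distinct checks would close a cycle of length 6. Which two checks coincide is left
  open: for an elementary set, every coincidence is excluded in the same way.\<close>

lemma no_6_cycle:
  assumes "girth E \<ge> 10"
    and "{u, c} \<in> E" "{v, c} \<in> E" "{v, d} \<in> E" "{w, d} \<in> E" "{w, e} \<in> E" "{u, e} \<in> E"
    and "u \<in> V" "v \<in> V" "w \<in> V" "distinct [u, v, w]"
  shows "\<not> distinct [c, d, e]"
proof
  assume "distinct [c, d, e]"
  moreover have "c \<in> C" "d \<in> C" "e \<in> C"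
    using assms edgeD by blast+
  ultimately have "is_cycle E [u, c, v, d, w, e]"
    using assms by (simp add: is_cycle_def All_less_Suc2 insert_commute variable_neq_check)
  from girth_le_length[OF this] assms(1) have "(10::enat) \<le> enat 6"
    using order_trans by fastforce
  then show False by (simp add: numeral_eq_enat)
qed

lemma no_8_cycle:
  assumes "girth E \<ge> 10"
    and "{u, c} \<in> E" "{v, c} \<in> E" "{v, d} \<in> E" "{w, d} \<in> E"
      "{w, e} \<in> E" "{x, e} \<in> E" "{x, f} \<in> E" "{u, f} \<in> E"
    and "u \<in> V" "v \<in> V" "w \<in> V" "x \<in> V" "distinct [u, v, w, x]"
  shows "\<not> distinct [c, d, e, f]"
proof
  assume "distinct [c, d, e, f]"
  moreover have "c \<in> C" "d \<in> C" "e \<in> C" "f \<in> C"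
    using assms edgeD by blast+
  ultimately have "is_cycle E [u, c, v, d, w, e, x, f]"
    using assms by (simp add: is_cycle_def All_less_Suc2 insert_commute variable_neq_check)
  from girth_le_length[OF this] assms(1) have "(10::enat) \<le> enat 8"
    using order_trans by fastforce
  then show False by (simp add: numeral_eq_enat)
qed

section \<open>The graph of shared checks on a trapping set\<close>

lemma elementary_trapping_set_size:
  assumes regular: "variable_regular V E \<gamma>" and girth: "girth E \<ge> 10"
    and ets: "elementary_trapping_set V C E a b S" and "b < a"
  shows "(\<gamma> - 1)\<^sup>2 + 1 \<le> a"
proof -
  define A where "A = adjacent_checks C E S"
  define T where "T c = {v \<in> S. {v, c} \<in> E}" for c
  define K where "K v = {c \<in> A. {v, c} \<in> E}" for v
  define N where "N v = (\<Union>c\<in>K v. T c - {v})" for v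
  have S: "S \<subseteq> V" "S \<noteq> {}" "card S = a"
    using ets by (auto simp: elementary_trapping_set_def trapping_set_def)
  have fin: "finite S" "finite A"
    using S finite_V finite_C finite_subset by (auto simp: A_def adjacent_checks_def)
  have fin_T: "finite (T c)" and fin_K: "finite (K v)" for c v
    using fin by (auto simp: T_def K_def)
  have card_T: "card (T c) \<in> {1, 2}" if "c \<in> A" for c
    using ets degree_check[of S c] S that
    by (fastforce simp: elementary_trapping_set_def A_def T_def)
  \<comment> \<open>As a sum of parities over \<open>A\<close>, \<open>b\<close> can be merged with
    the double count of edges below.\<close>
  have "b = card {c \<in> A. odd (card (T c))}"
    using ets degree_check[of S] S
    by (auto simp: elementary_trapping_set_def trapping_set_def A_def T_def intro!: arg_cong[where f = card])
  also have "\<dots> = (\<Sum>c\<in>A. if odd (card (T c)) then 1 else 0)"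
    using sum.inter_filter[OF fin(2), of "\<lambda>_. 1 :: nat" "\<lambda>c. odd (card (T c))"] by simp
  also have "\<dots> = (\<Sum>c\<in>A. card (T c) mod 2)"
    by (intro sum.cong refl) (simp add: mod_2_eq_odd)
  finally have b: "b = (\<Sum>c\<in>A. card (T c) mod 2)" .
  have K_eq: "K v = {c \<in> C. {v, c} \<in> E}" if "v \<in> S" for v
    using that by (auto simp: K_def A_def adjacent_checks_def)
  have card_K: "card (K v) = \<gamma>" if "v \<in> S" for v
    using regular degree_variable[of v] S that K_eq[OF that] by (auto simp: variable_regular_def)
  \<comment> \<open>Elementarity handles the degenerate short cycles: if two of their checks
    coincide, that check meets three elements of \<open>S\<close>.\<close>
  have no_triple: False
    if "c \<in> A" "u \<in> T c" "v \<in> T c" "w \<in> T c" "distinct [u, v, w]" for c u v w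
  proof -
    have "card {u, v, w} \<le> card (T c)"
      using that fin_T by (intro card_mono) auto
    with card_T[OF \<open>c \<in> A\<close>] that(5) show False by auto
  qed
  have N_iff: "u \<in> N v \<longleftrightarrow> u \<noteq> v \<and> u \<in> S \<and> (\<exists>c\<in>A. {u, c} \<in> E \<and> {v, c} \<in> E)" for u v
    by (auto simp: N_def K_def T_def)
  have card_N: "card (N v) = (\<Sum>c\<in>K v. card (T c) - 1)" if "v \<in> S" for v
  proof -
    have "card (N v) = (\<Sum>c\<in>K v. card (T c - {v}))"
      unfolding N_def
    proof (rule card_UN_disjoint)
      \<comment> \<open>Two checks sharing \<open>v\<close> and a further variable node would form a
        4-cycle. Hence no neighbour is reached through two checks.\<close>
      show "\<forall>c\<in>K v. \<forall>d\<in>K v. c \<noteq> d \<longrightarrow> (T c - {v}) \<inter> (T d - {v}) = {}"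
        using no_4_cycle[OF girth] S that unfolding K_def T_def by blast
    qed (use fin_T fin_K in auto)
    also have "\<dots> = (\<Sum>c\<in>K v. card (T c) - 1)"
      using that by (intro sum.cong) (auto simp: K_def T_def)
    finally show ?thesis .
  qed
  have double_count: "(\<Sum>v\<in>S. \<Sum>c\<in>K v. f c) = (\<Sum>c\<in>A. card (T c) * f c)" for f :: "'a \<Rightarrow> nat"
    using sum.swap_restrict[OF fin, of "\<lambda>_. f" "\<lambda>v c. {v, c} \<in> E"] by (simp add: K_def T_def)
  have "a * \<gamma> = (\<Sum>v\<in>S. \<Sum>c\<in>K v. 1)"
    using S card_K by simp
  also have "\<dots> = (\<Sum>c\<in>A. card (T c))"
    using double_count[of "\<lambda>_. 1"] by simp
  \<comment> \<open>The identity t = t(t - 1) + t mod 2 holds for t = 1 and t = 2, the only sizes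
    that occur.\<close>
  also have "\<dots> = (\<Sum>c\<in>A. card (T c) * (card (T c) - 1) + card (T c) mod 2)"
    by (intro sum.cong) (use card_T in fastforce)+
  also have "\<dots> = (\<Sum>v\<in>S. card (N v)) + b"
    using double_count[of "\<lambda>c. card (T c) - 1"] card_N b by (simp add: sum.distrib)
  finally have degree_sum: "a * \<gamma> = (\<Sum>v\<in>S. card (N v)) + b" .
  have "(\<gamma> - 1)\<^sup>2 + 1 \<le> card S"
  proof (rule moore_bound_girth_5[where N = N])
    show "(\<gamma> - 1) * card S \<le> (\<Sum>v\<in>S. card (N v))"
      using degree_sum \<open>b < a\<close> S by (simp add: diff_mult_distrib2 mult.commute)
    show "u \<notin> N w" if "v \<in> S" "u \<in> N v" "w \<in> N v" for u v w
    proof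
      assume "u \<in> N w"
      with that obtain c d e where
        edges: "c \<in> A" "{u, c} \<in> E" "{v, c} \<in> E" "d \<in> A" "{v, d} \<in> E" "{w, d} \<in> E"
          "e \<in> A" "{w, e} \<in> E" "{u, e} \<in> E"
        and verts: "u \<in> S" "w \<in> S" "distinct [u, v, w]"
        by (auto simp: N_iff)
      then have "\<not> distinct [c, d, e]"
        using no_6_cycle[OF girth, of u c v d w e] S \<open>v \<in> S\<close> by blast
      then obtain g where "g \<in> A" "u \<in> T g" "v \<in> T g" "w \<in> T g"
        using edges verts \<open>v \<in> S\<close> by (auto simp: T_def)
      with verts(3) show False using no_triple by blast
    qed
    show "x = v" if "v \<in> S" "u \<in> N v" "w \<in> N v" "u \<noteq> w" "x \<in> N u" "x \<in> N w" for u v w x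
    proof (rule ccontr)
      assume "x \<noteq> v"
      with that obtain c d e f where
        edges: "c \<in> A" "{v, c} \<in> E" "{u, c} \<in> E" "d \<in> A" "{u, d} \<in> E" "{x, d} \<in> E"
          "e \<in> A" "{x, e} \<in> E" "{w, e} \<in> E" "f \<in> A" "{w, f} \<in> E" "{v, f} \<in> E"
        and verts: "u \<in> S" "w \<in> S" "x \<in> S" "distinct [v, u, x, w]"
        by (auto simp: N_iff)
      then have "\<not> distinct [c, d, e, f]"
        using no_8_cycle[OF girth, of v c u d x e w f] S \<open>v \<in> S\<close> by blast
      \<comment> \<open>Cyclically adjacent checks that coincide meet three of the four vertices;
        opposite ones (\<open>c = e\<close>, \<open>d = f\<close>) meet all four.\<close>
      then consider "c = d" | "c = e" | "c = f" | "d = e" | "d = f" | "e = f"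
        by auto
      then obtain g p q r where "g \<in> A" "p \<in> T g" "q \<in> T g" "r \<in> T g" "distinct [p, q, r]"
        by cases (use edges verts \<open>v \<in> S\<close> that in \<open>auto simp: T_def\<close>)
      then show False using no_triple by blast
    qed
  qed (use S fin in \<open>auto simp: N_iff\<close>)
  with S show ?thesis by simp
qed

end

theorem theorem5:
  fixes V C :: "'a set" and E :: "'a set set" and \<gamma> a b :: nat and S :: "'a set"
  assumes "\<gamma> \<ge> 1"
    and "tanner_graph V C E"
    and "variable_regular V E \<gamma>"
    and "girth E \<ge> 10"
    and "elementary_trapping_set V C E a b S"
    and "real b / real a < 1"
  shows "a \<ge> (\<gamma> - 1)^2 + 1"
proof -
  interpret tanner_graph V C E by fact
  \<comment> \<open>Division by zero gives 0 in HOL, so the ratio hypothesis does not exclude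
    \<open>a = 0\<close>; nonemptiness of \<open>S\<close> does.\<close>
  have "a > 0"
    using assms(5) finite_subset[OF _ finite_V]
    by (auto simp: elementary_trapping_set_def trapping_set_def card_gt_0_iff)
  with assms(6) have "b < a"
    by (simp add: divide_simps)
  with assms show ?thesis
    using elementary_trapping_set_size by blast
qed

end
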